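(* If $H$ is a connected graph and $n\ge 1$, then $\mathrm{gp}_{\rm d}(K_n\boxtimes H)=n\cdot\mathrm{gp}_{\rm d}(H)$.
   Context: All graphs are finite and simple. For $X\subseteq V(G)$, two vertices $u,v$ are $X$-positionable if no shortest $u,v$-path has an internal vertex in $X$. $X$ is a dual general position set if every two vertices of $X$ are $X$-positionable and every two vertices of $V(G)\setminus X$ are $X$-positionable; $\mathrm{gp}_{\rm d}(G)$ is the maximum cardinality of such a set. The strong product $G\boxtimes H$ has vertex set $V(G)\times V(H)$, with $(g,h)$ and $(g',h')$ adjacent iff either $g=g'$ and $hh'\in E(H)$, or $gg'\in E(G)$ and $h=h'$, or $gg'\in E(G)$ and $hh'\in E(H)$. $K_n$ is the complete graph on $n$ vertices. *)

theory Defs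
  imports "Graph_Theory.Graph_Theory"
begin

text \<open>
  As in the library, a finite simple graph is a finite, symmetric, loop-free digraph without
  parallel arcs (\<^locale>\<open>pair_graph\<close>), so an undirected edge is a pair of opposite arcs.
  The \<^term>\<open>u\<close>,\<^term>\<open>v\<close>-paths of the undirected graph are then exactly the directed
  paths from \<^term>\<open>u\<close> to \<^term>\<open>v\<close>.
\<close>

context pre_digraph
begin

definition shortest_path :: "'a \<Rightarrow> 'b awalk \<Rightarrow> 'a \<Rightarrow> bool" where
  "shortest_path u p v \<longleftrightarrow> apath u p v \<and> (\<forall>q. apath u q v \<longrightarrow> length p \<le> length q)"

definition positionable :: "'a set \<Rightarrow> 'a \<Rightarrow> 'a \<Rightarrow> bool" where
  "positionable X u v \<longleftrightarrow> (\<forall>p. shortest_path u p v \<longrightarrow> set (inner_verts p) \<inter> X = {})"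

definition dual_gp_set :: "'a set \<Rightarrow> bool" where
  "dual_gp_set X \<longleftrightarrow> X \<subseteq> verts G
     \<and> pairwise (positionable X) X
     \<and> pairwise (positionable X) (verts G - X)"

text \<open>
  If \<^term>\<open>verts G\<close> is finite, this is the maximum of a finite set, which is nonempty because
  the empty set is a dual general position set.
\<close>

definition gp_d :: nat where
  "gp_d = Max (card ` {X. dual_gp_set X})"

end

definition strong_product ::
    "'a pair_pre_digraph \<Rightarrow> 'b pair_pre_digraph \<Rightarrow> ('a \<times> 'b) pair_pre_digraph" where
  "strong_product G H = \<lparr> pverts = pverts G \<times> pverts H,
    parcs = {((g, h), (g', h')) | g h g' h'.
      g \<in> pverts G \<and> g = g' \<and> (h, h') \<in> parcs H \<or>
      (g, g') \<in> parcs G \<and> h \<in> pverts H \<and> h = h' \<or>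
      (g, g') \<in> parcs G \<and> (h, h') \<in> parcs H} \<rparr>"

lemma pair_graph_strong_product:
  assumes "pair_graph G" "pair_graph H"
  shows "pair_graph (strong_product G H)"
proof -
  interpret G: pair_graph G by fact
  interpret H: pair_graph H by fact
  let ?P = "strong_product G H"
  have fst: "fst e \<in> pverts ?P" and snd: "snd e \<in> pverts ?P" and loop: "fst e \<noteq> snd e"
    if "e \<in> parcs ?P" for e
    using that
    by (auto simp: strong_product_def dest: G.in_arcsD1 G.in_arcsD2 H.in_arcsD1 H.in_arcsD2
        G.pair_no_loops H.pair_no_loops)
  have fin: "finite (pverts ?P)"
    using G.pair_finite_verts H.pair_finite_verts by (simp add: strong_product_def)
  have "parcs ?P \<subseteq> pverts ?P \<times> pverts ?P"
    using fst snd by (auto simp: mem_Times_iff)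
  then have "finite (parcs ?P)"
    using fin by (meson finite_SigmaI finite_subset)
  moreover have "sym (parcs ?P)"
    using G.pair_sym_arcs H.pair_sym_arcs
    by (auto simp: strong_product_def symmetric_def sym_def)
  ultimately show ?thesis
    using fst snd loop fin by unfold_locales (simp_all add: symmetric_def)
qed

lemma (in pre_digraph) dual_gp_set_empty: "dual_gp_set {}"
  by (simp add: dual_gp_set_def positionable_def pairwise_def)

end

theory Submission
  imports Defs
begin

text \<open>
  For \<^term>\<open>h \<noteq> h'\<close>, the distance from \<open>(k, h)\<close> to \<open>(k', h')\<close> in the product equals the distance
  from \<open>h\<close> to \<open>h'\<close> in \<open>H\<close>, and the interior vertices of shortest paths in the product are exactly
  the pairs whose second component is an interior vertex of a shortest path in \<open>H\<close>; for
  \<^term>\<open>h = h'\<close> there are no interior vertices. So \<open>A \<mapsto> V(K) \<times> A\<close> and \<open>X \<mapsto> snd ` X\<close> both preserve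
  dual general position sets, and \<open>X \<subseteq> V(K) \<times> snd ` X\<close> bounds the cardinality.
\<close>

section \<open>Walks, relation powers and shortest paths\<close>

context wf_digraph
begin

text \<open>The conjunct \<open>u \<in> verts G\<close> matters for \<open>n = 0\<close>: the power
  is then the identity on the whole type, whereas the empty walk has to start at a vertex.\<close>

lemma relpow_arcs_ends_iff_awalk:
  "u \<in> verts G \<and> (u, v) \<in> arcs_ends G ^^ n \<longleftrightarrow> (\<exists>p. awalk u p v \<and> length p = n)"
proof (induction n arbitrary: u)
  case 0
  then show ?case by (auto simp: awalk_Nil_iff)
next
  case (Suc n)
  have "u \<in> verts G \<and> (u, v) \<in> arcs_ends G ^^ Suc n \<longleftrightarrow>
      (\<exists>e \<in> arcs G. tail G e = u \<and> head G e \<in> verts G \<and> (head G e, v) \<in> arcs_ends G ^^ n)"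
    unfolding relpow.simps relpow_commute[symmetric] by (auto simp: arcs_ends_def arc_to_ends_def)
  also have "\<dots> \<longleftrightarrow> (\<exists>e \<in> arcs G. tail G e = u \<and> (\<exists>p. awalk (head G e) p v \<and> length p = n))"
    using Suc.IH by blast
  also have "\<dots> \<longleftrightarrow> (\<exists>p. awalk u p v \<and> length p = Suc n)"
    by (simp add: length_Suc_conv) (metis awalk_Cons_iff)
  finally show ?case .
qed

lemma awalk_to_apath_length_le:
  assumes "awalk u p v"
  shows "length (awalk_to_apath p) \<le> length p"
proof -
  have "distinct (awalk_to_apath p)"
    using apath_awalk_to_apath[OF assms] by (auto simp: apath_def distinct_verts_imp_distinct)
  then show ?thesis
    by (metis List.finite_set assms awalk_to_apath_subset card_length card_mono distinct_card le_trans)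
qed

text \<open>Shortening a walk to a path never makes it longer, and a shortest walk repeats no
  vertex, since a nonempty closed piece could be cut out. Only lengths of walks have to be compared
  from here on.\<close>

lemma shortest_path_iff_awalk:
  "shortest_path u p v \<longleftrightarrow> awalk u p v \<and> (\<forall>q. awalk u q v \<longrightarrow> length p \<le> length q)"
proof
  assume "shortest_path u p v"
  then show "awalk u p v \<and> (\<forall>q. awalk u q v \<longrightarrow> length p \<le> length q)"
    unfolding shortest_path_def
    by (meson apath_awalk_to_apath awalkI_apath awalk_to_apath_length_le le_trans)
next
  assume p: "awalk u p v \<and> (\<forall>q. awalk u q v \<longrightarrow> length p \<le> length q)"
  have "distinct (awalk_verts u p)"
  proof (rule ccontr)
    assume "\<not> distinct (awalk_verts u p)"
    then obtain q r s where "p = q @ r @ s" "r \<noteq> []" "\<exists>w. awalk u q w \<and> awalk w s v"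
      using awalk_not_distinct_decomp[of u p v] p by (metis length_greater_0_conv)
    then have "awalk u (q @ s) v" "length (q @ s) < length p"
      using awalk_appendI by auto
    then show False
      using p by (meson not_le)
  qed
  then show "shortest_path u p v"
    using p by (auto simp: shortest_path_def apath_def)
qed

end

section \<open>Interior vertices of shortest paths\<close>

text \<open>
  \<open>x\<close> is an interior vertex of a shortest path from \<open>u\<close> to \<open>v\<close>. The powers \<open>r ^^ n\<close> stand for walks of
  length \<open>n\<close>; by minimality of \<open>i + j\<close> the concatenated walk is automatically a path.
\<close>

definition interior_vertex :: "'a rel \<Rightarrow> 'a \<Rightarrow> 'a \<Rightarrow> 'a \<Rightarrow> bool" where
  "interior_vertex r u v x \<longleftrightarrow> (\<exists>i j. 0 < i \<and> 0 < j \<and> (u, x) \<in> r ^^ i \<and> (x, v) \<in> r ^^ j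
     \<and> (\<forall>m. (u, v) \<in> r ^^ m \<longrightarrow> i + j \<le> m))"

lemma (in wf_digraph) interior_vertex_iff_shortest_path:
  "interior_vertex (arcs_ends G) u v x \<longleftrightarrow> (\<exists>p. shortest_path u p v \<and> x \<in> set (inner_verts p))"
proof
  assume "interior_vertex (arcs_ends G) u v x"
  then obtain i j where ij: "0 < i" "0 < j" "(u, x) \<in> arcs_ends G ^^ i" "(x, v) \<in> arcs_ends G ^^ j"
    and min: "\<And>m. (u, v) \<in> arcs_ends G ^^ m \<Longrightarrow> i + j \<le> m"
    unfolding interior_vertex_def by blast
  \<comment> \<open>Both exponents are positive, so an arc leaves \<open>u\<close> and another
    leaves \<open>x\<close>.\<close>
  have "u \<in> verts G" "x \<in> verts G"
    using ij by (metis adj_in_verts(1) gr0_conv_Suc relpow_Suc_D2)+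
  then obtain q s where q: "awalk u q x" "length q = i" and s: "awalk x s v" "length s = j"
    using ij relpow_arcs_ends_iff_awalk by meson
  have "shortest_path u (q @ s) v"
    unfolding shortest_path_iff_awalk
    using q s min relpow_arcs_ends_iff_awalk awalk_appendI[OF q(1) s(1)] by (metis length_append)
  moreover have "x \<in> set (inner_verts (q @ s))"
    using q s ij by (cases q; cases s) (auto simp: inner_verts_def awalk_Cons_iff)
  ultimately show "\<exists>p. shortest_path u p v \<and> x \<in> set (inner_verts p)" by blast
next
  assume "\<exists>p. shortest_path u p v \<and> x \<in> set (inner_verts p)"
  then obtain p where p: "awalk u p v" and min: "\<And>q. awalk u q v \<Longrightarrow> length p \<le> length q"
    and x: "x \<in> set (inner_verts p)"
    unfolding shortest_path_iff_awalk by blast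
  obtain e p' where p': "p = e # p'"
    using x by (cases p) auto
  \<comment> \<open>\<open>inner_verts\<close> lists the tails of all arcs but the first, so
    \<open>x\<close> is the tail of some \<open>f\<close> after \<open>e\<close>. Cutting just
    before \<open>f\<close> leaves two nonempty walks, as positive \<open>i\<close> and
    \<open>j\<close> require.\<close>
  with x obtain f s t where st: "p' = s @ f # t" "tail G f = x"
    by (auto simp: inner_verts_def in_set_conv_decomp map_eq_append_conv)
  have "awalk u ((e # s) @ (f # t)) v"
    using p p' st by simp
  then have q: "awalk u (e # s) x" "awalk x (f # t) v"
    using st(2) unfolding awalk_append_iff by (auto simp: awalk_Cons_iff)
  show "interior_vertex (arcs_ends G) u v x"
    unfolding interior_vertex_def
  proof (intro exI conjI allI impI)
    show "(u, x) \<in> arcs_ends G ^^ length (e # s)" "(x, v) \<in> arcs_ends G ^^ length (f # t)"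
      using q relpow_arcs_ends_iff_awalk by blast+
    fix m assume "(u, v) \<in> arcs_ends G ^^ m"
    moreover have "u \<in> verts G" using p by auto
    ultimately obtain q' where "awalk u q' v" "length q' = m"
      using relpow_arcs_ends_iff_awalk by blast
    then show "length (e # s) + length (f # t) \<le> m"
      using min p' st by auto
  qed simp_all
qed

lemma (in wf_digraph) positionable_iff_interior_vertex:
  "positionable X u v \<longleftrightarrow> (\<forall>x\<in>X. \<not> interior_vertex (arcs_ends G) u v x)"
  unfolding positionable_def interior_vertex_iff_shortest_path by blast

text \<open>Letting \<open>B\<close> range over \<open>X\<close> and its complement allows one
  argument to treat both pairwise conditions.\<close>

lemma (in wf_digraph) dual_gp_set_iff_interior_vertex:
  "dual_gp_set X \<longleftrightarrow> X \<subseteq> verts G \<and> (\<forall>B\<in>{X, verts G - X}. \<forall>u\<in>B. \<forall>v\<in>B. u \<noteq> v \<longrightarrow>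
    (\<forall>x\<in>X. \<not> interior_vertex (arcs_ends G) u v x))"
  by (simp add: dual_gp_set_def pairwise_def positionable_iff_interior_vertex)

lemma interior_vertex_in_Range: "interior_vertex r u v x \<Longrightarrow> x \<in> Range r"
  unfolding interior_vertex_def by (metis RangeI gr0_conv_Suc relpow_Suc_E)

section \<open>Walks in the product and their projections\<close>

text \<open>Each arc of the product either projects to an arc of \<open>H\<close> or keeps the
  second component, so projection can only shorten a walk.\<close>

lemma relpow_strong_product_snd:
  assumes "(a, b) \<in> parcs (strong_product K H) ^^ n"
  shows "\<exists>m\<le>n. (snd a, snd b) \<in> parcs H ^^ m"
  using assms
proof (induction n arbitrary: b)
  case 0
  then show ?case by auto
next
  case (Suc n)
  then obtain c where "(a, c) \<in> parcs (strong_product K H) ^^ n"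
    and cb: "(c, b) \<in> parcs (strong_product K H)"
    by auto
  with Suc.IH obtain m where m: "m \<le> n" "(snd a, snd c) \<in> parcs H ^^ m" by blast
  have "snd c = snd b \<or> (snd c, snd b) \<in> parcs H"
    using cb by (auto simp: strong_product_def)
  then show ?case
  proof
    assume "snd c = snd b"
    then show ?case using m by (metis le_SucI)
  next
    assume "(snd c, snd b) \<in> parcs H"
    then show ?case using m by (meson Suc_le_mono relpow_Suc_I)
  qed
qed

locale complete_strong_product = H: pair_graph H
  for K :: "'a pair_pre_digraph" and H :: "'b pair_pre_digraph" +
  assumes finite_K: "finite (pverts K)"
    and parcs_K: "parcs K = {(k, k'). k \<in> pverts K \<and> k' \<in> pverts K \<and> k \<noteq> k'}"
    and K_nonempty: "pverts K \<noteq> {}"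
begin

abbreviation P where "P \<equiv> strong_product K H"

lemma pverts_P: "pverts P = pverts K \<times> pverts H"
  by (simp add: strong_product_def)

lemma parcs_P_iff:
  "((k, h), (k', h')) \<in> parcs P \<longleftrightarrow> k \<in> pverts K \<and> k' \<in> pverts K \<and>
    ((h, h') \<in> parcs H \<or> h = h' \<and> h \<in> pverts H \<and> k \<noteq> k')"
  by (auto simp: strong_product_def parcs_K)

sublocale P: pair_graph P
proof (rule pair_graph_strong_product)
  have "parcs K \<subseteq> pverts K \<times> pverts K"
    by (auto simp: parcs_K)
  then have "finite (parcs K)"
    using finite_K by (meson finite_SigmaI finite_subset)
  then show "pair_graph K"
    using finite_K by unfold_locales (auto simp: parcs_K symmetric_def sym_def)
qed (rule H.pair_graph_axioms)

text \<open>An arc of \<open>H\<close> lifts to an arc of \<open>P\<close> with arbitrary first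
  components from \<open>K\<close>. The lifted walk stays at \<open>k\<close> and moves to
  \<open>k'\<close> with its last arc, which exists because \<open>0 < m\<close>.\<close>

lemma relpow_P_lift:
  assumes "(h, h') \<in> parcs H ^^ m" "0 < m" "k \<in> pverts K" "k' \<in> pverts K"
  shows "((k, h), (k', h')) \<in> parcs P ^^ m"
  using assms
proof (induction m arbitrary: h' k')
  case 0
  then show ?case by simp
next
  case (Suc m)
  then obtain h'' where h'': "(h, h'') \<in> parcs H ^^ m" "(h'', h') \<in> parcs H"
    by auto
  have "((k, h''), (k', h')) \<in> parcs P"
    using h'' Suc.prems by (simp add: parcs_P_iff)
  moreover have "((k, h), (k, h'')) \<in> parcs P ^^ m"
    using Suc.IH[of h'' k] h'' Suc.prems by (cases "m = 0") auto
  ultimately show ?case by auto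
qed

text \<open>Projecting does not lengthen walks and lifting keeps positive lengths, so minimal
  lengths agree whenever \<open>h \<noteq> h'\<close>. The first components are therefore
  irrelevant, apart from lying in \<open>K\<close>.\<close>

lemma interior_vertex_P_iff:
  assumes "(k, h) \<in> pverts P" "(k', h') \<in> pverts P"
  shows "interior_vertex (parcs P) (k, h) (k', h') (k'', x) \<longleftrightarrow>
    k'' \<in> pverts K \<and> h \<noteq> h' \<and> interior_vertex (parcs H) h h' x"
proof
  assume L: "interior_vertex (parcs P) (k, h) (k', h') (k'', x)"
  then obtain i j where ij: "0 < i" "0 < j" "((k, h), (k'', x)) \<in> parcs P ^^ i"
      "((k'', x), (k', h')) \<in> parcs P ^^ j"
    and min: "\<And>m. ((k, h), (k', h')) \<in> parcs P ^^ m \<Longrightarrow> i + j \<le> m"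
    unfolding interior_vertex_def by blast
  have "h \<noteq> h'"
  proof
    assume "h = h'"
    \<comment> \<open>Vertices with the same second component are equal or adjacent, which
      contradicts \<open>i + j \<ge> 2\<close>.\<close>
    then have "((k, h), (k', h')) \<in> parcs P ^^ (if k = k' then 0 else 1)"
      using assms by (simp add: pverts_P parcs_P_iff)
    from min[OF this] ij show False by (simp split: if_splits)
  qed
  \<comment> \<open>As \<open>h \<noteq> h'\<close> rules out length 0, every walk from
    \<open>h\<close> to \<open>h'\<close> lifts.\<close>
  have min': "i + j \<le> m" if "(h, h') \<in> parcs H ^^ m" for m
    using min that relpow_P_lift[OF that] assms \<open>h \<noteq> h'\<close> by (cases "m = 0") (auto simp: pverts_P)
  obtain i' j' where i'j': "i' \<le> i" "j' \<le> j" "(h, x) \<in> parcs H ^^ i'" "(x, h') \<in> parcs H ^^ j'"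
    using relpow_strong_product_snd[OF ij(3)] relpow_strong_product_snd[OF ij(4)] by auto
  have "(h, h') \<in> parcs H ^^ (i' + j')"
    using i'j' by (auto simp: relpow_add)
  \<comment> \<open>The projected pieces together have length at most \<open>i + j\<close>, and
    minimality forbids less. Neither piece shrinks, so both stay nonempty.\<close>
  from min'[OF this] have "i' = i" "j' = j"
    using i'j' by auto
  then have "interior_vertex (parcs H) h h' x"
    using ij min' i'j' unfolding interior_vertex_def by blast
  moreover have "k'' \<in> pverts K"
    using interior_vertex_in_Range[OF L] by (auto simp: parcs_P_iff)
  ultimately show "k'' \<in> pverts K \<and> h \<noteq> h' \<and> interior_vertex (parcs H) h h' x"
    using \<open>h \<noteq> h'\<close> by blast
next
  assume R: "k'' \<in> pverts K \<and> h \<noteq> h' \<and> interior_vertex (parcs H) h h' x"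
  then obtain i j where ij: "0 < i" "0 < j" "(h, x) \<in> parcs H ^^ i" "(x, h') \<in> parcs H ^^ j"
    and min: "\<And>m. (h, h') \<in> parcs H ^^ m \<Longrightarrow> i + j \<le> m"
    unfolding interior_vertex_def by blast
  show "interior_vertex (parcs P) (k, h) (k', h') (k'', x)"
    unfolding interior_vertex_def
  proof (intro exI conjI allI impI)
    show "((k, h), (k'', x)) \<in> parcs P ^^ i" "((k'', x), (k', h')) \<in> parcs P ^^ j"
      using relpow_P_lift[OF ij(3,1)] relpow_P_lift[OF ij(4,2)] R assms by (simp_all add: pverts_P)
    fix m assume "((k, h), (k', h')) \<in> parcs P ^^ m"
    then show "i + j \<le> m"
      using relpow_strong_product_snd[of "(k, h)" "(k', h')"] min by fastforce
  qed (use ij in auto)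
qed

section \<open>Transfer of dual general position sets between \<open>H\<close> and the
  product\<close>

lemmas H_dual_gp_set_iff = H.dual_gp_set_iff_interior_vertex[unfolded with_proj_simps]

lemmas P_dual_gp_set_iff = P.dual_gp_set_iff_interior_vertex[unfolded with_proj_simps]

lemma dual_gp_set_Times:
  assumes "H.dual_gp_set A"
  shows "P.dual_gp_set (pverts K \<times> A)"
  unfolding P_dual_gp_set_iff
proof (intro conjI ballI impI notI)
  have A: "A \<subseteq> pverts H"
    using assms by (simp add: H_dual_gp_set_iff)
  then show "pverts K \<times> A \<subseteq> pverts P" by (auto simp: pverts_P)
  fix B a b x
  assume B: "B \<in> {pverts K \<times> A, pverts P - pverts K \<times> A}" and ab: "a \<in> B" "b \<in> B"
    and x: "x \<in> pverts K \<times> A" and int: "interior_vertex (parcs P) a b x"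
  have "a \<in> pverts P" "b \<in> pverts P"
    using A B ab by (auto simp: pverts_P)
  with int have int': "snd a \<noteq> snd b" "interior_vertex (parcs H) (snd a) (snd b) (snd x)"
    by (metis interior_vertex_P_iff prod.collapse)+
  \<comment> \<open>The complement of \<open>pverts K \<times> A\<close> is
    \<open>pverts K \<times> (pverts H - A)\<close>, so each of the two classes projects into the
    corresponding class of \<open>H\<close>.\<close>
  obtain C where C: "C \<in> {A, pverts H - A}" "snd a \<in> C" "snd b \<in> C"
  proof (cases "B = pverts K \<times> A")
    case True
    then show ?thesis using ab that[of A] by (simp add: mem_Times_iff)
  next
    case False
    with B have "B = pverts P - pverts K \<times> A" by simp
    then show ?thesis using ab that[of "pverts H - A"] by (simp add: pverts_P mem_Times_iff)
  qed
  have "snd x \<in> A"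
    using x by auto
  with assms[unfolded H_dual_gp_set_iff, THEN conjunct2, rule_format, OF C int'(1)] int'(2)
  show False by blast
qed

text \<open>A forbidden interior vertex in \<open>H\<close> lifts to one in the product. The lifts
  of \<open>h\<close>, \<open>h'\<close> and \<open>x\<close> may be chosen independently, because
  interior vertices do not depend on the first components.\<close>

lemma dual_gp_set_image_snd:
  assumes "P.dual_gp_set X"
  shows "H.dual_gp_set (snd ` X)"
  unfolding H_dual_gp_set_iff
proof (intro conjI ballI impI notI)
  have X: "X \<subseteq> pverts K \<times> pverts H"
    using assms by (simp add: P_dual_gp_set_iff pverts_P)
  then show "snd ` X \<subseteq> pverts H" by auto
  fix B h h' x
  assume B: "B \<in> {snd ` X, pverts H - snd ` X}" and h: "h \<in> B" "h' \<in> B" "h \<noteq> h'"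
    and x: "x \<in> snd ` X" and int: "interior_vertex (parcs H) h h' x"
  obtain k'' where k'': "(k'', x) \<in> X" using x by auto
  obtain C k k' where C: "C \<in> {X, pverts P - X}" "(k, h) \<in> C" "(k', h') \<in> C"
  proof (cases "B = snd ` X")
    case True
    then show ?thesis using h that[of X] by auto
  next
    case False
    with B have B: "B = pverts H - snd ` X" by simp
    obtain k where "k \<in> pverts K" using K_nonempty by blast
    then have "(k, h) \<in> pverts P - X" "(k, h') \<in> pverts P - X"
      using h(1,2) unfolding B pverts_P by force+
    then show ?thesis using that by blast
  qed
  have "(k, h) \<in> pverts P" "(k', h') \<in> pverts P" "k'' \<in> pverts K"
    using C X k'' by (auto simp: pverts_P)
  then have "interior_vertex (parcs P) (k, h) (k', h') (k'', x)"
    using h(3) int by (simp add: interior_vertex_P_iff)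
  moreover have "(k, h) \<noteq> (k', h')" using h(3) by simp
  ultimately show False
    using assms[unfolded P_dual_gp_set_iff, THEN conjunct2, rule_format, OF C] k'' by blast
qed

lemma finite_H_dual_gp_sets: "finite {A. H.dual_gp_set A}"
  by (rule finite_subset[of _ "Pow (pverts H)"]) (auto simp: H.dual_gp_set_def H.pair_finite_verts)

lemma gp_d_P: "P.gp_d = card (pverts K) * H.gp_d"
  unfolding P.gp_d_def
proof (rule Max_eqI)
  have "finite {X. P.dual_gp_set X}"
    by (rule finite_subset[of _ "Pow (pverts P)"]) (auto simp: P.dual_gp_set_def P.pair_finite_verts)
  then show "finite (card ` {X. P.dual_gp_set X})" by simp
next
  fix c assume "c \<in> card ` {X. P.dual_gp_set X}"
  then obtain X where X: "P.dual_gp_set X" "c = card X" by auto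
  have "X \<subseteq> pverts K \<times> snd ` X"
    using X by (force simp: P.dual_gp_set_def pverts_P)
  moreover have "finite (snd ` X)"
    using dual_gp_set_image_snd[OF X(1)] H.pair_finite_verts
    unfolding H.dual_gp_set_def by (metis finite_subset)
  ultimately have "card X \<le> card (pverts K) * card (snd ` X)"
    using finite_K by (metis card_cartesian_product card_mono finite_cartesian_product)
  also have "card (snd ` X) \<le> H.gp_d"
    unfolding H.gp_d_def using dual_gp_set_image_snd[OF X(1)] finite_H_dual_gp_sets
    by (intro Max_ge) blast+
  finally show "c \<le> card (pverts K) * H.gp_d" using X by simp
next
  \<comment> \<open>The empty set keeps the family nonempty, so its maximum is attained by some
    \<open>A\<close>.\<close>
  have "H.gp_d \<in> card ` {A. H.dual_gp_set A}"
    unfolding H.gp_d_def using finite_H_dual_gp_sets H.dual_gp_set_empty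
    by (intro Max_in) blast+
  then obtain A where A: "H.dual_gp_set A" "H.gp_d = card A" by blast
  show "card (pverts K) * H.gp_d \<in> card ` {X. P.dual_gp_set X}"
    unfolding A(2) card_cartesian_product[symmetric] using dual_gp_set_Times[OF A(1)] by blast
qed

end

theorem theorem4p7:
  fixes K :: "'a pair_pre_digraph" and H :: "'b pair_pre_digraph" and n :: nat
  assumes "n \<ge> 1"
    and "complete_digraph n (with_proj K)"
    and "pair_graph H"
    and "connected (with_proj H)"
  shows "pre_digraph.gp_d (with_proj (strong_product K H)) = n * pre_digraph.gp_d (with_proj H)"
proof -
  have K: "finite (pverts K)" "card (pverts K) = n"
    "parcs K = {(k, k'). k \<in> pverts K \<and> k' \<in> pverts K \<and> k \<noteq> k'}"
    using assms(2) by (auto simp: complete_digraph_pair_def)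
  interpret H: pair_graph H by fact
  interpret complete_strong_product K H
    \<comment> \<open>\<open>n \<ge> 1\<close> and \<open>card (pverts K) = n\<close> make
      \<open>pverts K\<close> nonempty.\<close>
    using K assms(1) by unfold_locales auto
  show ?thesis
    using gp_d_P K by simp
qed

end
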